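(* Let $D$ and $G$ be two Seymour-tight orientations. Then the lexicographic product $D[G]$ is also a Seymour-tight orientation. Moreover, if $D$ is a strongly connected Seymour-tight orientation, then $D[G]$ is also strongly connected.
   Context: An orientation is a directed graph that contains no cycles of length 2; equivalently, it is an assignment of a direction to each edge of an undirected graph. For a directed graph $G$ and $v\in V(G)$, $N_1(G,v)=\{w\in V(G) : (v,w)\in E(G)\}$ and $N_2(G,v)=\{w\in V(G)\setminus(N_1(G,v)\cup\{v\}) : \exists u\in N_1(G,v) \text{ with } (u,w)\in E(G)\}$. An orientation $G$ is Seymour-tight if $|N_1(G,v)|=|N_2(G,v)|$ for all $v\in V(G)$. The lexicographic product $D[G]$ of directed graphs $D$ and $G$ has vertex set $V(D)\times V(G)$, with an arc from $(v,i)$ to $(w,j)$ if and only if there is an arc from $v$ to $w$ in $D$, or $v=w$ and there is an arc from $i$ to $j$ in $G$. Two vertices $u,v$ of a directed graph lie in the same strongly connected component if there is a directed walk from $u$ to $v$ and a directed walk from $v$ to $u$; a directed graph is strongly connected if it has only one strongly connected component.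
   Formalization: Graphs are finite; the strong connectivity claim is stated for D with at least two vertices and G nonempty, since for a one-vertex D the product D[G] is just a copy of G, which need not be strongly connected (e.g. two isolated vertices). *)

theory Defs
  imports "Graph_Theory.Graph_Theory"
begin

text \<open>The locale \<open>pair_digraph\<close> supplies finite simple digraphs: arcs are ordered pairs of
  vertices, without loops.  The vertex set may be empty.\<close>

locale orientation = pair_digraph +
  assumes no_two_cycle: "(u, v) \<in> parcs G \<Longrightarrow> (v, u) \<notin> parcs G"

definition N1 :: "'a pair_pre_digraph \<Rightarrow> 'a \<Rightarrow> 'a set" where
  "N1 G v = {w \<in> pverts G. (v, w) \<in> parcs G}"

definition N2 :: "'a pair_pre_digraph \<Rightarrow> 'a \<Rightarrow> 'a set" where
  "N2 G v = {w \<in> pverts G - (N1 G v \<union> {v}). \<exists>u \<in> N1 G v. (u, w) \<in> parcs G}"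

locale seymour_tight_orientation = orientation +
  assumes seymour_tight: "v \<in> pverts G \<Longrightarrow> card (N1 G v) = card (N2 G v)"

text \<open>The \<open>'a\<close>-graph is the outer factor: each of its vertices is replaced by a copy of
  the \<open>'b\<close>-graph.\<close>

definition lex_product ::
    "'a pair_pre_digraph \<Rightarrow> 'b pair_pre_digraph \<Rightarrow> ('a \<times> 'b) pair_pre_digraph" where
  "lex_product D G =
    \<lparr> pverts = pverts D \<times> pverts G,
      parcs = {((v, i), (w, j)) | v i w j.
        v \<in> pverts D \<and> w \<in> pverts D \<and> i \<in> pverts G \<and> j \<in> pverts G \<and>
        ((v, w) \<in> parcs D \<or> v = w \<and> (i, j) \<in> parcs G)} \<rparr>"

end

theory Submission
  imports Defs
begin

text \<open>Since \<open>D\<close> has neither loops nor 2-cycles, a two-step walk in \<open>D[G]\<close> that ends in the fibre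
  it started from never leaves it, and a fibre reached from another one is reached entirely.  Hence \<open>N\<^sub>k(D[G], (v, i)) = N\<^sub>k(D, v) \<times> V(G) \<union> {v} \<times> N\<^sub>k(G, i)\<close> for \<open>k = 1, 2\<close>,
  and both unions are disjoint.  A nonempty walk in \<open>D\<close> lifts to \<open>D[G]\<close> with arbitrary second
  coordinates at its ends, and any two vertices of a strongly connected \<open>D\<close> with at least two
  vertices are joined by a nonempty walk.\<close>

lemma pverts_lex_product [simp]: "pverts (lex_product D G) = pverts D \<times> pverts G"
  by (simp add: lex_product_def)

lemma parcs_lex_product_iff:
  "((v, i), (w, j)) \<in> parcs (lex_product D G) \<longleftrightarrow>
    v \<in> pverts D \<and> w \<in> pverts D \<and> i \<in> pverts G \<and> j \<in> pverts G \<and>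
    ((v, w) \<in> parcs D \<or> v = w \<and> (i, j) \<in> parcs G)"
  by (simp add: lex_product_def)

lemma pair_digraph_lex_product:
  assumes "pair_digraph D" and "pair_digraph G"
  shows "pair_digraph (lex_product D G)"
proof -
  interpret D: pair_digraph D by fact
  interpret G: pair_digraph G by fact
  have sub: "parcs (lex_product D G) \<subseteq> (pverts D \<times> pverts G) \<times> (pverts D \<times> pverts G)"
    by (auto simp: parcs_lex_product_iff)
  have fin: "finite (pverts D \<times> pverts G)"
    using D.pair_finite_verts G.pair_finite_verts by simp
  show ?thesis
  proof
    show "finite (parcs (lex_product D G))"
      using sub fin by (meson finite_SigmaI finite_subset)
    fix e assume "e \<in> parcs (lex_product D G)"
    then show "fst e \<noteq> snd e"
      by (cases e) (auto simp: parcs_lex_product_iff dest: D.no_loops' G.no_loops')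
  qed (use sub fin in auto)
qed

text \<open>A 2-cycle projects to a 2-cycle of \<open>D\<close>, or lies in one fibre and is a
  2-cycle of \<open>G\<close>; mixing the two kinds of arc would give a loop in
  \<open>D\<close>.\<close>

lemma orientation_lex_product:
  assumes "orientation D" and "orientation G"
  shows "orientation (lex_product D G)"
proof -
  interpret D: orientation D by fact
  interpret G: orientation G by fact
  interpret P: pair_digraph "lex_product D G"
    by (intro pair_digraph_lex_product D.pair_digraph G.pair_digraph)
  show ?thesis
  proof
    fix u v assume "(u, v) \<in> parcs (lex_product D G)"
    then show "(v, u) \<notin> parcs (lex_product D G)"
      by (cases u; cases v)
        (auto simp: parcs_lex_product_iff
          dest: D.no_two_cycle G.no_two_cycle D.no_loops' G.no_loops')
  qed
qed

lemma N1_lex_product: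
  assumes "v \<in> pverts D" and "i \<in> pverts G"
  shows "N1 (lex_product D G) (v, i) = N1 D v \<times> pverts G \<union> {v} \<times> N1 G i"
  using assms by (auto simp: N1_def parcs_lex_product_iff)

text \<open>Off the fibre of \<open>v\<close>, a two-step walk with a step inside a fibre ends where
  \<open>(v, i)\<close> already has an arc, so only two-step walks of \<open>D\<close> count. On
  that fibre, leaving and returning would be a 2-cycle of \<open>D\<close>.\<close>

lemma N2_lex_product:
  assumes "orientation D" and "v \<in> pverts D" and "i \<in> pverts G"
  shows "N2 (lex_product D G) (v, i) = N2 D v \<times> pverts G \<union> {v} \<times> N2 G i"
proof -
  interpret D: orientation D by fact
  have "(w, j) \<in> N2 (lex_product D G) (v, i) \<longleftrightarrow>
      (w, j) \<in> N2 D v \<times> pverts G \<union> {v} \<times> N2 G i" for w j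
    using assms(2,3)
    by (cases "w = v")
      (auto simp: N2_def N1_lex_product bex_Un N1_def parcs_lex_product_iff
        dest: D.no_loops' D.no_two_cycle)
  then show ?thesis by auto
qed

lemma card_fibre_union:
  assumes "finite A" and "finite B" and "finite C" and "v \<notin> A"
  shows "card (A \<times> B \<union> {v} \<times> C) = card A * card B + card C"
proof -
  have "A \<times> B \<inter> {v} \<times> C = {}" using assms(4) by auto
  then show ?thesis using assms by (simp add: card_Un_disjoint card_cartesian_product)
qed

lemma seymour_tight_orientation_lex_product:
  assumes "seymour_tight_orientation D" and "seymour_tight_orientation G"
  shows "seymour_tight_orientation (lex_product D G)"
proof -
  interpret D: seymour_tight_orientation D by fact
  interpret G: seymour_tight_orientation G by fact
  interpret P: orientation "lex_product D G"
    by (intro orientation_lex_product D.orientation_axioms G.orientation_axioms)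
  show ?thesis
  proof
    fix x assume "x \<in> pverts (lex_product D G)"
    then obtain v i where x: "x = (v, i)" and v: "v \<in> pverts D" and i: "i \<in> pverts G" by auto
    have fin: "finite (N1 D v)" "finite (N2 D v)" "finite (N1 G i)" "finite (N2 G i)"
      using D.pair_finite_verts G.pair_finite_verts by (auto simp: N1_def N2_def)
    \<comment> \<open>Disjointness for \<open>card_fibre_union\<close>: both cardinalities become
      |N_k(D, v)| |V(G)| + |N_k(G, i)|, and tightness of \<open>D\<close> and of \<open>G\<close>
      equates them term by term.\<close>
    have "v \<notin> N1 D v" "v \<notin> N2 D v" by (auto simp: N1_def N2_def dest: D.no_loops')
    then show "card (N1 (lex_product D G) x) = card (N2 (lex_product D G) x)"
      using fin v i G.pair_finite_verts D.seymour_tight[OF v] G.seymour_tight[OF i]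
      by (simp add: x N1_lex_product N2_lex_product[OF D.orientation_axioms] card_fibre_union)
  qed
qed

text \<open>An arc of \<open>D\<close> lifts to arcs between all pairs of vertices of the two
  fibres, so the second coordinate can be chosen afresh at each step.\<close>

lemma trancl_lex_product:
  assumes "pair_wf_digraph D" and "(v, w) \<in> (parcs D)\<^sup>+" and "i \<in> pverts G" and "j \<in> pverts G"
  shows "((v, i), (w, j)) \<in> (parcs (lex_product D G))\<^sup>+"
proof -
  interpret D: pair_wf_digraph D by fact
  have arc: "((x, k), (y, l)) \<in> parcs (lex_product D G)"
    if "(x, y) \<in> parcs D" "k \<in> pverts G" "l \<in> pverts G" for x y k l
    using that D.wellformed' by (auto simp: parcs_lex_product_iff)
  from assms(2,4) show ?thesis
  proof (induction arbitrary: j rule: trancl_induct)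
    case (base y)
    then show ?case using arc assms(3) by blast
  next
    case (step y z)
    then show ?case using arc assms(3) by (meson trancl_into_trancl)
  qed
qed

lemma strongly_connected_imp_trancl:
  assumes "pair_wf_digraph D" and sc: "strongly_connected (with_proj D)"
    and "2 \<le> card (pverts D)" and v: "v \<in> pverts D" and w: "w \<in> pverts D"
  shows "(v, w) \<in> (parcs D)\<^sup>+"
proof -
  interpret D: pair_wf_digraph D by fact
  have neq: "(x, y) \<in> (parcs D)\<^sup>+" if "x \<in> pverts D" "y \<in> pverts D" "x \<noteq> y" for x y
    using sc that D.reachable_neq_reachable1 by (auto simp: strongly_connected_def)
  \<comment> \<open>Reachability is reflexive, so for \<open>v = w\<close> it yields no arc; a
    second vertex \<open>u\<close> supplies the closed walk from \<open>v\<close> to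
    \<open>u\<close> and back.\<close>
  have "\<not> pverts D \<subseteq> {v}"
    using assms(3) card_mono[of "{v}" "pverts D"] by auto
  then obtain u where "u \<in> pverts D" "u \<noteq> v" by auto
  then show ?thesis
    using neq[OF v, of u] neq[of u v] neq[OF v w] v by (cases "v = w") (auto intro: trancl_trans)
qed

text \<open>Two vertices of one fibre are joined by lifting a nonempty closed walk of
  \<open>D\<close>, whatever the arcs of \<open>G\<close>. For a one-vertex \<open>D\<close> the
  product is a copy of \<open>G\<close>, hence the cardinality bound.\<close>

lemma strongly_connected_lex_product:
  assumes D: "pair_digraph D" and G: "pair_digraph G" and sc: "strongly_connected (with_proj D)"
    and card: "2 \<le> card (pverts D)" and ne: "pverts G \<noteq> {}"
  shows "strongly_connected (with_proj (lex_product D G))"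
proof -
  interpret D: pair_digraph D by fact
  interpret P: pair_digraph "lex_product D G" using D G by (rule pair_digraph_lex_product)
  have "(x, y) \<in> (parcs (lex_product D G))\<^sup>+"
    if "x \<in> pverts D \<times> pverts G" "y \<in> pverts D \<times> pverts G" for x y
    using that by (auto intro!: trancl_lex_product strongly_connected_imp_trancl sc card)
  \<comment> \<open>\<open>strongly_connected\<close> also demands a vertex, which the product has
    once both factors have one.\<close>
  then show ?thesis
    using sc ne P.reachable1_reachable by (auto simp: strongly_connected_def)
qed

theorem lemma3p1:
  fixes D :: "'a pair_pre_digraph" and G :: "'b pair_pre_digraph"
  assumes "seymour_tight_orientation D" and "seymour_tight_orientation G"
  shows "seymour_tight_orientation (lex_product D G) \<and>
    (strongly_connected (with_proj D) \<and> 2 \<le> card (pverts D) \<and> pverts G \<noteq> {} \<longrightarrow>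
      strongly_connected (with_proj (lex_product D G)))"
proof -
  interpret D: seymour_tight_orientation D by fact
  interpret G: seymour_tight_orientation G by fact
  show ?thesis
    using seymour_tight_orientation_lex_product[OF assms]
      strongly_connected_lex_product[OF D.pair_digraph G.pair_digraph] by blast
qed

end
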